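(* Let $N$ be a positive integer and let $a,b$ be real parameters such that no denominator in the definition of the functions below vanishes. The rational functions of $q$-Hahn type $\mathcal U_m(n)=\mathcal U_m(n;a,b,N;q)$ obey the following difference equation for $m,n=0,1,\dots,N$: $$\mathcal B_n\,\mathcal U_m(n+1)-(\mathcal B_n+\mathcal D_n)\,\mathcal U_m(n)+\mathcal D_n\,\mathcal U_m(n-1)=[m]_q[N-m-b]_q\Big([a-n]_q\,\mathcal U_m(n)-q^a[-n]_q\,\mathcal U_m(n-1)\Big),$$ where $$\mathcal B_n=q^{n-b}[a-n]_q[a-n-1]_q[N-n]_q,\qquad \mathcal D_n=q^n[-n]_q[a-n]_q[N-n+a-b]_q.$$
   Context: $q$ is real, $q>0$, $q\ne1$; $[x]_q=\frac{1-q^x}{1-q}$; $(a;q)_0=1$, $(a;q)_k=\prod_{i=0}^{k-1}(1-aq^i)$. For $m=0,\dots,N$, $$\mathcal U_m(x;a,b,N;q)=q^{m(N-m-b)}\frac{(q^{-N};q)_m}{(q^{-m-b};q)_m}\sum_{k=0}^m\frac{(q^{-m};q)_k(q^{-x};q)_k(q^{b+m-N};q)_k}{(q^{-N};q)_k(q^{a-x};q)_k}\frac{q^k}{(q;q)_k}.$$ Note that $\mathcal B_N=0$ and $\mathcal D_0=[-0]_q=0$, so the values $\mathcal U_m(N+1)$ and $\mathcal U_m(-1)$ do not contribute. The nonvanishing of denominators holds for instance if $a$ and $b$ are not integers. *)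

theory Defs
  imports Complex_Main
begin

definition q_bracket :: "real \<Rightarrow> real \<Rightarrow> real" where
  "q_bracket q x = (1 - q powr x) / (1 - q)"

definition q_pochhammer :: "real \<Rightarrow> real \<Rightarrow> nat \<Rightarrow> real" where
  "q_pochhammer a q k = (\<Prod>i<k. 1 - a * q ^ i)"

definition qHahn_U :: "nat \<Rightarrow> real \<Rightarrow> real \<Rightarrow> real \<Rightarrow> nat \<Rightarrow> real \<Rightarrow> real" where
  "qHahn_U m x a b N q =
     q powr (real m * (real N - real m - b))
     * (q_pochhammer (q powr (- real N)) q m / q_pochhammer (q powr (- real m - b)) q m)
     * (\<Sum>k = 0..m.
          (q_pochhammer (q powr (- real m)) q k * q_pochhammer (q powr (- x)) q k
             * q_pochhammer (q powr (b + real m - real N)) q k)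
          / (q_pochhammer (q powr (- real N)) q k * q_pochhammer (q powr (a - x)) q k)
          * (q ^ k / q_pochhammer q q k))"

(* Only the grid points x = 0, ..., N are required to be free of vanishing denominators.
   In the difference equation the values at x = -1 and x = N + 1 are multiplied by zero
   coefficients, so the value they get from division by zero is irrelevant. *)
definition qHahn_U_admissible :: "real \<Rightarrow> real \<Rightarrow> nat \<Rightarrow> real \<Rightarrow> bool" where
  "qHahn_U_admissible a b N q \<longleftrightarrow>
     (\<forall>m\<le>N. q_pochhammer (q powr (- real m - b)) q m \<noteq> 0
        \<and> (\<forall>x\<le>N. \<forall>k\<le>m. q_pochhammer (q powr (- real N)) q k \<noteq> 0
              \<and> q_pochhammer (q powr (a - real x)) q k \<noteq> 0
              \<and> q_pochhammer q q k \<noteq> 0))"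

definition coeff_B :: "real \<Rightarrow> real \<Rightarrow> nat \<Rightarrow> real \<Rightarrow> nat \<Rightarrow> real" where
  "coeff_B a b N q n =
     q powr (real n - b) * q_bracket q (a - real n) * q_bracket q (a - real n - 1)
     * q_bracket q (real N - real n)"

definition coeff_D :: "real \<Rightarrow> real \<Rightarrow> nat \<Rightarrow> real \<Rightarrow> nat \<Rightarrow> real" where
  "coeff_D a b N q n =
     q ^ n * q_bracket q (- real n) * q_bracket q (a - real n)
     * q_bracket q (real N - real n + a - b)"

end

theory Submission
  imports Defs
begin

text \<open>
  Up to a factor independent of \<open>x\<close>, the function \<open>U\<^sub>m\<close> is the sum of \<open>c\<^sub>k \<phi>\<^sub>k(x)\<close> with
  \<open>\<phi>\<^sub>k(x) = (q\<^sup>-\<^sup>x;q)\<^sub>k / (q\<^sup>a\<^sup>-\<^sup>x;q)\<^sub>k\<close>. Put \<open>X = q\<^sup>-\<^sup>n\<close>, \<open>A = q\<^sup>a\<^sup>-\<^sup>n\<close> and \<open>v\<^sub>k = (X;q)\<^sub>k / (A;q)\<^sub>k\<^sub>+\<^sub>1\<close>.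
  The operator on the right maps \<open>\<phi>\<^sub>k\<close> to a multiple of \<open>v\<^sub>k\<close>, and the one on the left maps it to a
  combination of \<open>v\<^sub>k\<close> and \<open>v\<^sub>k\<^sub>-\<^sub>1\<close>. The coefficients are such that the sum over \<open>k\<close> telescopes, and the
  upper boundary term contains the factor \<open>1 - q\<^sup>m q\<^sup>-\<^sup>m = 0\<close>.
\<close>

lemma q_pochhammer_0 [simp]: "q_pochhammer a q 0 = 1"
  by (simp add: q_pochhammer_def)

lemma q_pochhammer_Suc: "q_pochhammer a q (Suc k) = q_pochhammer a q k * (1 - a * q ^ k)"
  by (simp add: q_pochhammer_def)

lemma q_pochhammer_Suc_shift: "q_pochhammer a q (Suc k) = (1 - a) * q_pochhammer (a * q) q k"
  unfolding q_pochhammer_def prod.lessThan_Suc_shift by (simp add: mult.assoc)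

lemma q_pochhammer_nonzero_mono:
  assumes "q_pochhammer a q k \<noteq> 0" "j \<le> k"
  shows "q_pochhammer a q j \<noteq> 0"
  using assms unfolding q_pochhammer_def by auto

text \<open>This is phi_k, and \<open>q_ratio'\<close> below is v_k. Keeping \<open>X\<close> and
  \<open>A\<close> as variables turns a step of n by one into multiplication or division of both by
  \<open>q\<close>.\<close>

definition q_ratio :: "real \<Rightarrow> real \<Rightarrow> real \<Rightarrow> nat \<Rightarrow> real" where
  "q_ratio q X A k = q_pochhammer X q k / q_pochhammer A q k"

definition q_ratio' :: "real \<Rightarrow> real \<Rightarrow> real \<Rightarrow> nat \<Rightarrow> real" where
  "q_ratio' q X A k = q_pochhammer X q k / q_pochhammer A q (Suc k)"

lemma q_pochhammer_one: "k > 0 \<Longrightarrow> q_pochhammer 1 q k = 0"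
  by (cases k) (simp_all add: q_pochhammer_Suc_shift)

text \<open>The alternative \<open>X = 1\<close> covers \<open>n = 0\<close>, where \<open>A q\<^sup>N = 1\<close> is not excluded by admissibility.\<close>

lemma q_ratio_eq:
  assumes "A \<noteq> 1" and "X = 1 \<or> A * q ^ k \<noteq> 1"
  shows "q_ratio q X A k = q_ratio' q X A k * (1 - A * q ^ k)"
proof (cases "A * q ^ k = 1")
  case True
  with assms have "X = 1" "k > 0" by (auto intro: gr0I)
  then show ?thesis by (simp add: q_ratio_def q_ratio'_def q_pochhammer_one)
next
  case False
  then show ?thesis by (simp add: q_ratio_def q_ratio'_def q_pochhammer_Suc)
qed

lemma q_ratio_Suc:
  "q_ratio q X A (Suc k) = q_ratio' q X A k * (1 - X * q ^ k)"
  by (simp add: q_ratio_def q_ratio'_def q_pochhammer_Suc)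

text \<open>The step from n to n - 1: splitting off the first or the last factor of (X;q)_{k+1}
  gives two products for it. The factor \<open>1 - X\<close> is supplied by D_n and by the
  right-hand operator.\<close>

lemma q_ratio_backward:
  assumes "A \<noteq> 1"
  shows "(1 - X) * q_ratio q (X * q) (A * q) k = (1 - A) * (1 - X * q ^ k) * q_ratio' q X A k"
proof -
  have "(1 - X) * q_pochhammer (X * q) q k = q_pochhammer X q k * (1 - X * q ^ k)"
    by (metis q_pochhammer_Suc q_pochhammer_Suc_shift)
  then show ?thesis
    using assms by (simp add: q_ratio_def q_ratio'_def q_pochhammer_Suc_shift[of A] mult_ac)
qed

text \<open>The step from n to n + 1: splitting off the first factors of numerator and denominator
  leaves (X;q)_k and (A;q)_k.\<close>

lemma q_ratio_forward:
  assumes "q_pochhammer (A / q) q (Suc k) \<noteq> 0" and "q \<noteq> 0" and "A * q ^ k \<noteq> 1"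
  shows "(1 - A / q) * q_ratio q (X / q) (A / q) (Suc k)
         = (1 - X / q) * (1 - A * q ^ k) * q_ratio' q X A k"
  using assms by (simp add: q_ratio_def q_ratio'_def q_pochhammer_Suc_shift[of "X / q"]
      q_pochhammer_Suc_shift[of "A / q"] q_pochhammer_Suc[of A])

text \<open>The rational core of \<open>q_ratio_contiguity\<close>, divided by 1 - A:
  \<open>R\<close> is q^k, \<open>p\<close> is v_k and \<open>v\<close> is v_{k+1}. Both sides of
  \<open>rel\<close> are phi_{k+1}.\<close>

lemma contiguity_identity:
  fixes q X \<alpha> \<beta> \<nu> R p v :: real
  assumes "q \<noteq> 0" "X \<noteq> 0" "\<beta> \<noteq> 0" "\<nu> \<noteq> 0" "R \<noteq> 0"
    and rel: "p * (1 - X * R) = v * (1 - \<alpha> * X * (q * R))"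
  shows "(1 - \<nu> * X) / (X * \<beta>) * ((1 - X / q) * (1 - \<alpha> * X * R) * p)
     - ((1 - \<alpha> * X / q) * (1 - \<nu> * X) / (X * \<beta>) + (1 - X) * (1 - \<nu> * X * \<alpha> / \<beta>) / X)
         * (v * (1 - \<alpha> * X * (q * R)))
     + (1 - \<nu> * X * \<alpha> / \<beta>) / X * ((1 - \<alpha> * X) * (1 - X * (q * R)) * v)
   = (1 - q * R) * (1 - \<alpha>) * \<nu> / (\<beta> * (q * R))
       * ((1 - R / \<nu>) * p - (1 - \<beta> * (q * R) / \<nu>) * v)"
  (is "?lhs = ?rhs")
proof -
  let ?E = "q * R + (\<alpha> * \<nu> - \<nu> - \<alpha> * R * (1 + \<nu> * q)) * X + \<alpha> * R * \<nu> * X\<^sup>2"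
  \<comment> \<open>Both sides are linear in \<open>p\<close> and \<open>v\<close>; \<open>?E\<close> is the coefficient of \<open>p\<close> in the difference,
    cleared of denominators and divided by \<open>1 - X * R\<close>.\<close>
  have "?lhs - ?rhs = ?E / (\<beta> * X * q * R) * (p * (1 - X * R) - v * (1 - \<alpha> * X * (q * R)))"
    using assms(1-5) by (simp add: divide_simps) algebra
  with rel show ?thesis by simp
qed

text \<open>Here \<alpha> = q^a, \<beta> = q^b, \<nu> = q^N, and \<open>B\<close>, \<open>D\<close>
  are B_n, D_n times (1 - q)^3. The alternatives \<open>X = 1\<close> and
  \<open>\<nu> * X = 1\<close> are the ends n = 0 and n = N, where \<open>D\<close> or
  \<open>B\<close> vanishes and the value off the grid is irrelevant.\<close>

lemma q_ratio_contiguity: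
  fixes q X \<alpha> \<beta> \<nu> :: real
  assumes nz: "q \<noteq> 0" "X \<noteq> 0" "\<beta> \<noteq> 0" "\<nu> \<noteq> 0"
    and A: "A = \<alpha> * X" "q_pochhammer A q (Suc k) \<noteq> 0"
    and bwd: "X = 1 \<or> A * q ^ Suc k \<noteq> 1"
    and fwd: "\<nu> * X = 1 \<or> q_pochhammer (A / q) q (Suc k) \<noteq> 0"
  defines "B \<equiv> (1 - A) * (1 - A / q) * (1 - \<nu> * X) / (X * \<beta>)"
    and "D \<equiv> (1 - X) * (1 - A) * (1 - \<nu> * X * \<alpha> / \<beta>) / X"
  shows "B * q_ratio q (X / q) (A / q) (Suc k) - (B + D) * q_ratio q X A (Suc k)
       + D * q_ratio q (X * q) (A * q) (Suc k)
     = (1 - A) * (1 - q ^ Suc k) * (1 - \<alpha>) * \<nu> / (\<beta> * q ^ Suc k)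
         * ((1 - q ^ k / \<nu>) * q_ratio' q X A k - (1 - \<beta> * q ^ Suc k / \<nu>) * q_ratio' q X A (Suc k))"
proof -
  define p where "p = q_ratio' q X A k"
  define v where "v = q_ratio' q X A (Suc k)"
  have A1: "A \<noteq> 1" and Ak: "A * q ^ k \<noteq> 1"
    using A(2) q_pochhammer_Suc_shift[of A q k] by (auto simp: q_pochhammer_Suc)
  have f: "q_ratio q X A (Suc k) = v * (1 - A * q ^ Suc k)"
    unfolding v_def using A1 bwd by (rule q_ratio_eq)
  have rel: "p * (1 - X * q ^ k) = v * (1 - A * q ^ Suc k)"
    using f unfolding p_def q_ratio_Suc .
  have b: "(1 - X) * q_ratio q (X * q) (A * q) (Suc k) = (1 - A) * (1 - X * q ^ Suc k) * v"
    unfolding v_def using A1 by (rule q_ratio_backward)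
  have Bf: "B * q_ratio q (X / q) (A / q) (Suc k)
      = (1 - A) * ((1 - \<nu> * X) / (X * \<beta>) * ((1 - X / q) * (1 - A * q ^ k) * p))"
  proof (cases "\<nu> * X = 1")
    case False
    with fwd nz(1) Ak have "(1 - A / q) * q_ratio q (X / q) (A / q) (Suc k)
         = (1 - X / q) * (1 - A * q ^ k) * p"
      unfolding p_def by (intro q_ratio_forward) auto
    then show ?thesis unfolding B_def by (simp add: mult_ac)
  qed (simp add: B_def)
  have Db: "D * q_ratio q (X * q) (A * q) (Suc k)
      = (1 - A) * ((1 - \<nu> * X * \<alpha> / \<beta>) / X * ((1 - A) * (1 - X * q ^ Suc k) * v))"
    unfolding b[symmetric] D_def by simp
  have BD: "B + D = (1 - A) * ((1 - A / q) * (1 - \<nu> * X) / (X * \<beta>)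
      + (1 - X) * (1 - \<nu> * X * \<alpha> / \<beta>) / X)"
    unfolding B_def D_def by (simp add: distrib_left mult_ac)
  \<comment> \<open>Restores the common factor u = 1 - A that \<open>contiguity_identity\<close>
    omits.\<close>
  have factor: "u * x - u * s * t + u * y = u * w * z * \<nu> / d * r"
    if "x - s * t + y = w * z * \<nu> / d * r" for u x s t y w z d r :: real
    using arg_cong[OF that, of "times u"] by (simp add: algebra_simps)
  show ?thesis
    unfolding Bf Db BD f p_def[symmetric] v_def[symmetric]
    unfolding A(1) power_Suc
    by (rule factor, rule contiguity_identity[OF nz])
      (use nz(1) rel[unfolded A(1) power_Suc] in simp_all)
qed

text \<open>Both terms are multiples of v_k, and since A = \<alpha> X their parts containing q^k
  cancel.\<close>

lemma q_ratio_first_order: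
  assumes "A = \<alpha> * X" "A \<noteq> 1" "X = 1 \<or> A * q ^ k \<noteq> 1"
  shows "(1 - A) * q_ratio q X A k - \<alpha> * (1 - X) * q_ratio q (X * q) (A * q) k
    = (1 - A) * (1 - \<alpha>) * q_ratio' q X A k"
proof -
  have *: "\<alpha> * (1 - X) * q_ratio q (X * q) (A * q) k
      = \<alpha> * ((1 - A) * (1 - X * q ^ k) * q_ratio' q X A k)"
    using q_ratio_backward[OF assms(2), of X q k] by simp
  then show ?thesis
    unfolding * q_ratio_eq[OF assms(2,3)] unfolding assms(1) by (simp add: algebra_simps)
qed

text \<open>The coefficient c_k, with \<mu> = q^m, \<beta> = q^b, \<nu> = q^N as variables so that
  the later identities are rational.\<close>

definition qHahn_coeff :: "real \<Rightarrow> real \<Rightarrow> real \<Rightarrow> real \<Rightarrow> nat \<Rightarrow> real" where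
  "qHahn_coeff q \<mu> \<beta> \<nu> k = q_pochhammer (1 / \<mu>) q k * q_pochhammer (\<beta> * \<mu> / \<nu>) q k * q ^ k
     / (q_pochhammer (1 / \<nu>) q k * q_pochhammer q q k)"

lemma qHahn_coeff_Suc:
  assumes "q_pochhammer (1 / \<nu>) q (Suc k) \<noteq> 0" "q_pochhammer q q (Suc k) \<noteq> 0"
  shows "qHahn_coeff q \<mu> \<beta> \<nu> (Suc k) * ((1 - q ^ Suc k) * (1 - q ^ k / \<nu>))
    = qHahn_coeff q \<mu> \<beta> \<nu> k * (q * (1 - q ^ k / \<mu>) * (1 - \<beta> * \<mu> * q ^ k / \<nu>))"
  using assms by (auto simp: qHahn_coeff_def q_pochhammer_Suc mult_ac)

text \<open>\<open>\<kappa>\<close> is (1 - q)^2 [m]_q [N-m-b]_q. With \<open>\<mu>\<close> free,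
  the partial sums have a closed form that can be proved by induction on \<open>j\<close>; \<mu> =
  q^m enters only in the final theorem.\<close>

lemma qHahn_telescoping:
  fixes q X \<alpha> \<beta> \<nu> \<mu> :: real
  assumes nz: "q \<noteq> 0" "X \<noteq> 0" "\<beta> \<noteq> 0" "\<nu> \<noteq> 0" "\<mu> \<noteq> 0"
    and A: "A = \<alpha> * X" "A \<noteq> 1" "q_pochhammer A q j \<noteq> 0"
    and bwd: "X = 1 \<or> (\<forall>k\<le>j. A * q ^ k \<noteq> 1)"
    and fwd: "\<nu> * X = 1 \<or> q_pochhammer (A / q) q j \<noteq> 0"
    and c: "q_pochhammer (1 / \<nu>) q j \<noteq> 0" "q_pochhammer q q j \<noteq> 0"
  defines "B \<equiv> (1 - A) * (1 - A / q) * (1 - \<nu> * X) / (X * \<beta>)"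
    and "D \<equiv> (1 - X) * (1 - A) * (1 - \<nu> * X * \<alpha> / \<beta>) / X"
    and "\<kappa> \<equiv> (1 - \<mu>) * (1 - \<nu> / (\<mu> * \<beta>))"
  shows "(\<Sum>k\<le>j. qHahn_coeff q \<mu> \<beta> \<nu> k *
      (B * q_ratio q (X / q) (A / q) k - (B + D) * q_ratio q X A k
        + D * q_ratio q (X * q) (A * q) k
        - \<kappa> * ((1 - A) * q_ratio q X A k - \<alpha> * (1 - X) * q_ratio q (X * q) (A * q) k)))
    = - (qHahn_coeff q \<mu> \<beta> \<nu> j * ((1 - q ^ j / \<mu>) * (1 - \<beta> * \<mu> * q ^ j / \<nu>)
        * (\<nu> / (\<beta> * q ^ j)) * (1 - A) * (1 - \<alpha>) * q_ratio' q X A j))"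
  using A(3) bwd fwd c
proof (induction j)
  case 0
  have *: "(1 - A) - \<alpha> * (1 - X) = 1 - \<alpha>" using A(1) by (simp add: algebra_simps)
  \<comment> \<open>The second-order part annihilates phi_0 = 1, so \<open>\<kappa>\<close> must be
    the boundary coefficient at j = 0.\<close>
  have **: "\<kappa> = (1 - 1 / \<mu>) * (1 - \<beta> * \<mu> / \<nu>) * (\<nu> / \<beta>)"
    unfolding \<kappa>_def using nz by (simp add: divide_simps) algebra
  have "(1 - A) * q_ratio' q X A 0 = 1"
    using A(2) by (simp add: q_ratio'_def q_pochhammer_Suc)
  then show ?case
    by (simp add: q_ratio_def * **)
next
  case (Suc k)
  let ?Q = "q ^ Suc k"
  define C where "C = qHahn_coeff q \<mu> \<beta> \<nu>"
  define p where "p = q_ratio' q X A k"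
  define v where "v = q_ratio' q X A (Suc k)"
  have fo: "(1 - A) * q_ratio q X A (Suc k) - \<alpha> * (1 - X) * q_ratio q (X * q) (A * q) (Suc k)
    = (1 - A) * (1 - \<alpha>) * v"
    unfolding v_def using A(1,2) Suc.prems(2) by (intro q_ratio_first_order) auto
  have so: "B * q_ratio q (X / q) (A / q) (Suc k) - (B + D) * q_ratio q X A (Suc k)
       + D * q_ratio q (X * q) (A * q) (Suc k)
     = (1 - A) * (1 - ?Q) * (1 - \<alpha>) * \<nu> / (\<beta> * ?Q)
         * ((1 - q ^ k / \<nu>) * p - (1 - \<beta> * ?Q / \<nu>) * v)"
    unfolding B_def D_def p_def v_def
    using nz(1-4) A(1) Suc.prems by (intro q_ratio_contiguity) auto
  have cc: "C (Suc k) * ((1 - ?Q) * (1 - q ^ k / \<nu>))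
    = C k * (q * (1 - q ^ k / \<mu>) * (1 - \<beta> * \<mu> * q ^ k / \<nu>))"
    unfolding C_def using Suc.prems(4,5) by (rule qHahn_coeff_Suc)
  \<comment> \<open>As polynomials in \<open>?Q\<close> the two products differ only in the linear
    term, so after division by \<open>?Q\<close> the difference is the constant
    \<open>\<kappa>\<close>. The terms in v_{k+1} thus form the new boundary term.\<close>
  have key: "(1 - ?Q / \<mu>) * (1 - \<beta> * \<mu> * ?Q / \<nu>) * (\<nu> / (\<beta> * ?Q))
    = (1 - ?Q) * (1 - \<beta> * ?Q / \<nu>) * (\<nu> / (\<beta> * ?Q)) + \<kappa>"
    unfolding \<kappa>_def using nz by (simp add: divide_simps) algebra
  have pre: "q_pochhammer A q k \<noteq> 0" "X = 1 \<or> (\<forall>i\<le>k. A * q ^ i \<noteq> 1)"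
    "\<nu> * X = 1 \<or> q_pochhammer (A / q) q k \<noteq> 0"
    "q_pochhammer (1 / \<nu>) q k \<noteq> 0" "q_pochhammer q q k \<noteq> 0"
    using Suc.prems by (auto simp: q_pochhammer_Suc)
  define W where "W = (1 - A) * (1 - \<alpha>)"
  \<comment> \<open>The v_k part coming from phi_{k+1} cancels the boundary term of the induction
    hypothesis.\<close>
  have low: "C (Suc k) * ((1 - ?Q) * (1 - q ^ k / \<nu>)) * (\<nu> / (\<beta> * ?Q))
      = C k * ((1 - q ^ k / \<mu>) * (1 - \<beta> * \<mu> * q ^ k / \<nu>) * (\<nu> / (\<beta> * q ^ k)))"
    unfolding cc using nz by simp
  have "C (Suc k) * ((1 - A) * (1 - ?Q) * (1 - \<alpha>) * \<nu> / (\<beta> * ?Q)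
         * ((1 - q ^ k / \<nu>) * p - (1 - \<beta> * ?Q / \<nu>) * v) - \<kappa> * ((1 - A) * (1 - \<alpha>) * v))
    = C (Suc k) * ((1 - ?Q) * (1 - q ^ k / \<nu>)) * (\<nu> / (\<beta> * ?Q)) * (W * p)
      - C (Suc k) * ((1 - ?Q) * (1 - \<beta> * ?Q / \<nu>) * (\<nu> / (\<beta> * ?Q)) + \<kappa>) * (W * v)"
    unfolding W_def times_divide_eq_right[symmetric] by algebra
  also have "\<dots> = C k * ((1 - q ^ k / \<mu>) * (1 - \<beta> * \<mu> * q ^ k / \<nu>) * (\<nu> / (\<beta> * q ^ k))) * (W * p)
      - C (Suc k) * ((1 - ?Q / \<mu>) * (1 - \<beta> * \<mu> * ?Q / \<nu>) * (\<nu> / (\<beta> * ?Q))) * (W * v)"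
    unfolding low key ..
  finally show ?case
    unfolding sum.atMost_Suc Suc.IH[OF pre] fo so
    unfolding C_def[symmetric] p_def[symmetric] v_def[symmetric] W_def
    by (simp only: mult.assoc)
qed

lemma qHahn_U_eq:
  assumes "q > 0"
  shows "\<exists>K. \<forall>x. qHahn_U m x a b N q = K * (\<Sum>k\<le>m.
    qHahn_coeff q (q powr real m) (q powr b) (q powr real N) k * q_ratio q (q powr - x) (q powr (a - x)) k)"
proof (intro exI allI)
  fix x
  have *: "q powr - real m = 1 / q powr real m" "q powr - real N = 1 / q powr real N"
    "q powr (b + real m - real N) = q powr b * q powr real m / q powr real N"
    using assms by (simp_all add: powr_minus_divide powr_add powr_diff)
  show "qHahn_U m x a b N q = (q powr (real m * (real N - real m - b))
     * (q_pochhammer (q powr (- real N)) q m / q_pochhammer (q powr (- real m - b)) q m)) * (\<Sum>k\<le>m.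
    qHahn_coeff q (q powr real m) (q powr b) (q powr real N) k * q_ratio q (q powr - x) (q powr (a - x)) k)"
    unfolding qHahn_U_def qHahn_coeff_def q_ratio_def * atMost_atLeast0
    by (rule arg_cong2[of _ _ _ _ "(*)", OF refl sum.cong[OF refl]]) (simp add: mult_ac)
qed

theorem proposition7p5:
  fixes q a b :: real and N m n :: nat
  assumes "q > 0" and "q \<noteq> 1"
    and "N > 0"
    and "qHahn_U_admissible a b N q"
    and "m \<le> N" and "n \<le> N"
  shows
    "coeff_B a b N q n * qHahn_U m (real n + 1) a b N q
       - (coeff_B a b N q n + coeff_D a b N q n) * qHahn_U m (real n) a b N q
       + coeff_D a b N q n * qHahn_U m (real n - 1) a b N q
     = q_bracket q (real m) * q_bracket q (real N - real m - b)
       * (q_bracket q (a - real n) * qHahn_U m (real n) a b N q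
          - q powr a * q_bracket q (- real n) * qHahn_U m (real n - 1) a b N q)"
proof -
  define X where "X = q powr - real n"
  define \<alpha> where "\<alpha> = q powr a"
  define \<beta> where "\<beta> = q powr b"
  define \<nu> where "\<nu> = q powr real N"
  define \<mu> where "\<mu> = q powr real m"
  define A where "A = q powr (a - real n)"
  have nz: "q \<noteq> 0" "X \<noteq> 0" "\<beta> \<noteq> 0" "\<nu> \<noteq> 0" "\<mu> \<noteq> 0"
    using assms(1) by (simp_all add: X_def \<beta>_def \<nu>_def \<mu>_def)
  have A: "A = \<alpha> * X"
    unfolding A_def \<alpha>_def X_def by (simp flip: powr_add)
  have adm: "q_pochhammer (q powr (a - real x)) q N \<noteq> 0"
      "q_pochhammer (q powr - real N) q N \<noteq> 0" "q_pochhammer q q N \<noteq> 0" if "x \<le> N" for x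
    using assms(4) that unfolding qHahn_U_admissible_def by auto
  have nonzero: "q_pochhammer A q N \<noteq> 0"
    unfolding A_def using adm(1) assms(6) .
  \<comment> \<open>Since N > 0, \<open>1 - A\<close> is the first factor of (A;q)_N.\<close>
  have A1: "A \<noteq> 1"
    using q_pochhammer_nonzero_mono[OF nonzero, of 1] assms(3) by (simp add: q_pochhammer_Suc)
  have Am: "q_pochhammer A q m \<noteq> 0"
    using q_pochhammer_nonzero_mono[OF nonzero assms(5)] .
  have shift: "q powr (a - (real n + 1)) = A / q" "q powr - (real n + 1) = X / q"
     "q powr (a - (real n - 1)) = A * q" "q powr - (real n - 1) = X * q"
    using assms(1) unfolding A_def X_def
    by (simp_all add: powr_diff powr_add powr_minus field_simps)
  \<comment> \<open>The grid point n alone does not control the factor 1 - A q^N; for n > 0 the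
    point n - 1 does.\<close>
  have bwd: "X = 1 \<or> (\<forall>k\<le>m. A * q ^ k \<noteq> 1)"
  proof (cases "n = 0")
    case True
    then show ?thesis using assms(1) by (simp add: X_def)
  next
    case False
    then have "q_pochhammer (A * q) q N \<noteq> 0"
      using adm(1)[of "n - 1"] assms(6) shift(3) by (simp add: of_nat_diff)
    with A1 have "q_pochhammer A q (Suc N) \<noteq> 0"
      by (simp add: q_pochhammer_Suc_shift)
    then have "A * q ^ k \<noteq> 1" if "k \<le> m" for k
      using q_pochhammer_nonzero_mono[of A q "Suc N" "Suc k"] that assms(5)
      by (auto simp: q_pochhammer_Suc)
    then show ?thesis by blast
  qed
  have fwd: "\<nu> * X = 1 \<or> q_pochhammer (A / q) q m \<noteq> 0"
  proof (cases "n = N")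
    case True
    then show ?thesis using assms(1) by (simp add: X_def \<nu>_def flip: powr_add)
  next
    case False
    then have "q_pochhammer (A / q) q N \<noteq> 0"
      using adm(1)[of "n + 1"] assms(6) shift(1) by (simp add: add.commute)
    then show ?thesis using q_pochhammer_nonzero_mono assms(5) by blast
  qed
  have c: "q_pochhammer (1 / \<nu>) q m \<noteq> 0" "q_pochhammer q q m \<noteq> 0"
    using q_pochhammer_nonzero_mono[OF adm(2) assms(5)] q_pochhammer_nonzero_mono[OF adm(3) assms(5)]
    by (auto simp: \<nu>_def powr_minus_divide)
  define B where "B = (1 - A) * (1 - A / q) * (1 - \<nu> * X) / (X * \<beta>)"
  define D where "D = (1 - X) * (1 - A) * (1 - \<nu> * X * \<alpha> / \<beta>) / X"
  define \<kappa> where "\<kappa> = (1 - \<mu>) * (1 - \<nu> / (\<mu> * \<beta>))"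
  \<comment> \<open>One \<open>K\<close> serves n - 1, n and n + 1; the equation is homogeneous in
    U_m, so its value does not matter.\<close>
  obtain K where K: "qHahn_U m x a b N q = K * (\<Sum>k\<le>m.
    qHahn_coeff q \<mu> \<beta> \<nu> k * q_ratio q (q powr - x) (q powr (a - x)) k)" for x
    using qHahn_U_eq[OF assms(1)] unfolding \<mu>_def \<beta>_def \<nu>_def by blast
  define S where "S Y C = (\<Sum>k\<le>m. qHahn_coeff q \<mu> \<beta> \<nu> k * q_ratio q Y C k)" for Y C
  have U: "qHahn_U m (real n + 1) a b N q = K * S (X / q) (A / q)"
    "qHahn_U m (real n) a b N q = K * S X A"
    "qHahn_U m (real n - 1) a b N q = K * S (X * q) (A * q)"
    unfolding K S_def shift by (simp_all only: A_def X_def)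
  have "B * S (X / q) (A / q) - (B + D) * S X A + D * S (X * q) (A * q)
      - \<kappa> * ((1 - A) * S X A - \<alpha> * (1 - X) * S (X * q) (A * q))
    = (\<Sum>k\<le>m. qHahn_coeff q \<mu> \<beta> \<nu> k *
      (B * q_ratio q (X / q) (A / q) k - (B + D) * q_ratio q X A k
        + D * q_ratio q (X * q) (A * q) k
        - \<kappa> * ((1 - A) * q_ratio q X A k - \<alpha> * (1 - X) * q_ratio q (X * q) (A * q) k)))"
    unfolding S_def by (simp add: sum_distrib_left sum.distrib sum_subtractf algebra_simps)
  \<comment> \<open>At j = m the boundary term contains 1 - q^m / \<mu> = 0.\<close>
  also have "\<dots> = 0"
    unfolding B_def D_def \<kappa>_def qHahn_telescoping[OF nz A A1 Am bwd fwd c]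
    using assms(1) by (simp add: \<mu>_def powr_realpow)
  finally have main: "B * S (X / q) (A / q) - (B + D) * S X A + D * S (X * q) (A * q)
      = \<kappa> * ((1 - A) * S X A - \<alpha> * (1 - X) * S (X * q) (A * q))"
    by simp
  have qn: "q ^ n = 1 / X"
    using assms(1) by (simp add: X_def powr_minus_divide powr_realpow)
  have powrs: "q powr (real n - b) = 1 / (X * \<beta>)" "q powr (real N - real n) = \<nu> * X"
    "q powr (a - real n - 1) = A / q" "q powr (real N - real n + a - b) = \<nu> * X * \<alpha> / \<beta>"
    "q powr (real N - real m - b) = \<nu> / (\<mu> * \<beta>)"
    using assms(1) unfolding X_def \<beta>_def \<nu>_def A_def \<alpha>_def \<mu>_def
    by (simp_all add: powr_diff powr_add powr_minus field_simps)
  \<comment> \<open>Each bracket contributes one factor \<open>e\<close>, so both sides of the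
    equation carry e^3.\<close>
  define e where "e = inverse (1 - q)"
  have BD: "coeff_B a b N q n = e ^ 3 * B" "coeff_D a b N q n = e ^ 3 * D"
    unfolding coeff_B_def coeff_D_def q_bracket_def powrs qn B_def D_def e_def
    by (simp_all add: X_def[symmetric] A_def[symmetric] divide_inverse power3_eq_cube)
  have br: "q_bracket q (real m) * q_bracket q (real N - real m - b) = e ^ 2 * \<kappa>"
    "q_bracket q (a - real n) = e * (1 - A)" "q_bracket q (- real n) = e * (1 - X)"
    unfolding q_bracket_def powrs \<kappa>_def e_def
    by (simp_all add: X_def[symmetric] A_def[symmetric] \<mu>_def[symmetric] divide_inverse power2_eq_square)
  show ?thesis
    unfolding U BD br \<alpha>_def[symmetric] using main by algebra
qed

end
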